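(* Let $\mathcal{D} = [\underline{x}, \overline{x}]$ be a compact interval of positive length $|\mathcal{D}| = \overline{x} - \underline{x} > 0$, let $f : \mathcal{D} \to \mathbb{R}$ be globally Lipschitz continuous with constant $L > 0$, and let $\varepsilon > 0$. Then, for any $\Delta > 0$ with $\Delta \leq \varepsilon/(3L)$ and $|\mathcal{D}|/\Delta \in \mathbb{N}$, one can choose intervals $\mathcal{D}_k$, $k \in \{1, \dots, |\mathcal{D}|/\Delta\}$, forming a partition of $\mathcal{D}$ with $|\mathcal{D}_k| = \Delta$, and, setting $a_k = -4L/\Delta$, there exist $b_k, c_k \in \mathbb{R}$ such that the parabolas $p_k(x) = a_k x^2 + b_k x + c_k$, $k \in \{1, \dots, |\mathcal{D}|/\Delta\}$, fulfill $$f(x) - \varepsilon \leq p_k(x) \quad \text{for all } x \in \mathcal{D}_k, \qquad \text{and} \qquad p_k(x) \leq f(x) \quad \text{for all } x \in \mathcal{D}.$$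
   Context: $\mathbb{N} = \{1, 2, 3, \dots\}$. For an interval, $|\cdot|$ denotes its length. A partition of $\mathcal{D}$ into intervals here means closed intervals $\mathcal{D}_k = [t_{k-1}, t_k]$ with $\underline{x} = t_0 < t_1 < \dots < t_K = \overline{x}$ (consecutive intervals share an endpoint), so that $\bigcup_k \mathcal{D}_k = \mathcal{D}$. *)

theory Defs
  imports "HOL-Analysis.Analysis"
begin

text \<open>
  The pieces are \<open>D 1, \<dots>, D K\<close>; the value of \<open>D\<close> at other indices is irrelevant.
  Unlike \<open>division_of\<close>, this fixes the left-to-right enumeration of the pieces.
\<close>

definition interval_partition :: "real \<Rightarrow> real \<Rightarrow> nat \<Rightarrow> (nat \<Rightarrow> real set) \<Rightarrow> bool" where
  "interval_partition xl xu K D \<longleftrightarrow>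
     (\<exists>t :: nat \<Rightarrow> real. t 0 = xl \<and> t K = xu \<and>
        (\<forall>k\<in>{1..K}. t (k - 1) < t k \<and> D k = {t (k - 1)..t k}))"

end

theory Submission
  imports Defs
begin

text \<open>
  Around any point \<open>m\<close>, a Lipschitz function \<open>f\<close> lies above the cone \<open>f m - L * \<bar>x - m\<bar>\<close>. A downward
  parabola with apex over \<open>m\<close> fits below this cone, on the whole domain, as soon as its apex is
  lowered enough to clear the corner of the cone; for curvature coefficient \<open>A\<close> the necessary gap is
  \<open>L\<^sup>2 / (4 * A)\<close> (lemma \<open>parabola_below_lipschitz\<close>). Conversely, within distance \<open>r\<close> of \<open>m\<close> the
  parabola has dropped by at most \<open>A * r\<^sup>2\<close> and \<open>f\<close> has risen by at most \<open>L * r\<close>, which bounds the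
  approximation error (lemma \<open>parabola_near_lipschitz\<close>).

  Now cut the domain into cells of length \<open>\<Delta>\<close> and take such a parabola at the midpoint of each cell,
  with \<open>A = 4 * L / \<Delta>\<close>. On a cell one has \<open>r = \<Delta> / 2\<close>, and the error is at most
  \<open>(1/16 + 1 + 1/2) * L * \<Delta>\<close>, hence below \<open>3 * L * \<Delta> \<le> \<epsilon>\<close>.
\<close>

text \<open>
  At distance \<open>u\<close> from \<open>m\<close>, the cone exceeds the parabola by \<open>A * (u - L / (2 * A))\<^sup>2\<close>; the two graphs
  touch at \<open>u = L / (2 * A)\<close>, so the gap \<open>L\<^sup>2 / (4 * A)\<close> is optimal when \<open>f\<close> is the cone itself and its
  domain reaches that far.
\<close>

lemma parabola_below_lipschitz:
  fixes f :: "real \<Rightarrow> real"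
  assumes "L-lipschitz_on S f" "A > 0" "m \<in> S" "x \<in> S"
  shows "f m - L\<^sup>2 / (4 * A) - A * (x - m)\<^sup>2 \<le> f x"
proof -
  have "\<bar>f m - f x\<bar> \<le> L * \<bar>x - m\<bar>"
    using lipschitz_onD[OF assms(1,3,4)] by (simp add: dist_real_def abs_minus_commute)
  moreover have "A * (\<bar>x - m\<bar> - L / (2 * A))\<^sup>2 = A * (x - m)\<^sup>2 - L * \<bar>x - m\<bar> + L\<^sup>2 / (4 * A)"
    using \<open>A > 0\<close> by (simp add: power2_diff) (simp add: field_simps power2_eq_square)
  moreover have "0 \<le> A * (\<bar>x - m\<bar> - L / (2 * A))\<^sup>2"
    using \<open>A > 0\<close> by simp
  ultimately show ?thesis
    by linarith
qed

lemma parabola_near_lipschitz: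
  fixes f :: "real \<Rightarrow> real"
  assumes "L-lipschitz_on S f" "A > 0" "m \<in> S" "x \<in> S" "\<bar>x - m\<bar> \<le> r"
  shows "f x - (L * r + A * r\<^sup>2 + L\<^sup>2 / (4 * A)) \<le> f m - L\<^sup>2 / (4 * A) - A * (x - m)\<^sup>2"
proof -
  have "\<bar>f m - f x\<bar> \<le> L * \<bar>x - m\<bar>"
    using lipschitz_onD[OF assms(1,3,4)] by (simp add: dist_real_def abs_minus_commute)
  also have "\<dots> \<le> L * r"
    using lipschitz_on_nonneg[OF assms(1)] assms(5) by (rule mult_left_mono[rotated])
  finally have "\<bar>f m - f x\<bar> \<le> L * r" .
  moreover have "A * (x - m)\<^sup>2 \<le> A * r\<^sup>2"
    using assms(2,5) power_mono[of "\<bar>x - m\<bar>" r 2] by simp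
  ultimately show ?thesis
    by linarith
qed

theorem theorem4:
  fixes xl xu L \<epsilon> \<Delta> :: real
    and f :: "real \<Rightarrow> real"
    and K :: nat
  assumes "xl < xu"
    and "L > 0"
    and "L-lipschitz_on {xl..xu} f"
    and "\<epsilon> > 0"
    and "\<Delta> > 0"
    and "\<Delta> \<le> \<epsilon> / (3 * L)"
    and "K \<ge> 1"
    and "(xu - xl) / \<Delta> = real K"
  shows "\<exists>D. interval_partition xl xu K D \<and>
           (\<forall>k\<in>{1..K}. measure lborel (D k) = \<Delta>) \<and>
           (let a = (\<lambda>k::nat. - 4 * L / \<Delta>) in
            \<exists>b c :: nat \<Rightarrow> real.
              let p = (\<lambda>k x. a k * x\<^sup>2 + b k * x + c k) in
              \<forall>k\<in>{1..K}.
                (\<forall>x\<in>D k. f x - \<epsilon> \<le> p k x) \<and>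
                (\<forall>x\<in>{xl..xu}. p k x \<le> f x))"
proof -
  define t where "t = (\<lambda>k::nat. xl + real k * \<Delta>)"
  define m where "m = (\<lambda>k. t k - \<Delta> / 2)"
  define A where "A = 4 * L / \<Delta>"
  define D where "D = (\<lambda>k. {t (k - 1)..t k})"
  \<comment> \<open>The coefficients that result from expanding the parabola with apex over the midpoint \<open>m k\<close>.\<close>
  define b where "b = (\<lambda>k. 2 * A * m k)"
  define c where "c = (\<lambda>k. f (m k) - L\<^sup>2 / (4 * A) - A * (m k)\<^sup>2)"
  have "A > 0"
    using assms(2,5) by (simp add: A_def)
  have step: "t (k - 1) = t k - \<Delta>" if "k \<in> {1..K}" for k
    using that by (simp add: t_def of_nat_diff algebra_simps)
  have last: "t K = xu"
    using assms(5,8) by (simp add: t_def field_simps)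
  have first: "t 0 = xl"
    by (simp add: t_def)
  have "mono t"
    using assms(5) by (auto intro!: monoI mult_right_mono simp: t_def)
  then have D_sub: "D k \<subseteq> {xl..xu}" if "k \<in> {1..K}" for k
    using that monoD[of t 0 "k - 1"] monoD[of t k K] first last by (auto simp: D_def)
  have m_dist: "\<bar>x - m k\<bar> \<le> \<Delta> / 2" if "k \<in> {1..K}" "x \<in> D k" for k x
    using that step[of k] by (auto simp: D_def m_def abs_if)
  have m_in: "m k \<in> {xl..xu}" if "k \<in> {1..K}" for k
  proof -
    have "m k \<in> D k"
      using step[OF that] assms(5) by (simp add: D_def m_def)
    then show ?thesis
      using D_sub[OF that] by blast
  qed
  have vertex_form: "- 4 * L / \<Delta> * x\<^sup>2 + b k * x + c k
      = f (m k) - L\<^sup>2 / (4 * A) - A * (x - m k)\<^sup>2" for k x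
  proof -
    have "- 4 * L / \<Delta> = - A"
      by (simp add: A_def)
    then show ?thesis
      unfolding b_def c_def by (simp add: power2_eq_square algebra_simps)
  qed
  have error: "L * (\<Delta> / 2) + A * (\<Delta> / 2)\<^sup>2 + L\<^sup>2 / (4 * A) \<le> \<epsilon>"
  proof -
    have "L * (\<Delta> / 2) + A * (\<Delta> / 2)\<^sup>2 + L\<^sup>2 / (4 * A) = 25 / 16 * (L * \<Delta>)"
      using assms(2,5) by (simp add: A_def field_simps power2_eq_square)
    moreover have "3 * (L * \<Delta>) \<le> \<epsilon>"
      using assms(2,6) by (simp add: field_simps)
    moreover have "0 < L * \<Delta>"
      using assms(2,5) by simp
    ultimately show ?thesis
      by linarith
  qed
  have "interval_partition xl xu K D"
    unfolding interval_partition_def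
    using first last step assms(5) by (intro exI[of _ t]) (auto simp: D_def)
  moreover have "\<forall>k\<in>{1..K}. measure lborel (D k) = \<Delta>"
    using step assms(5) by (simp add: D_def)
  moreover have "f x - \<epsilon> \<le> - 4 * L / \<Delta> * x\<^sup>2 + b k * x + c k"
    if "k \<in> {1..K}" "x \<in> D k" for k x
  proof -
    have "x \<in> {xl..xu}"
      using D_sub that by blast
    from parabola_near_lipschitz[OF assms(3) \<open>A > 0\<close> m_in[OF that(1)] this m_dist[OF that]]
    show ?thesis
      using error unfolding vertex_form by linarith
  qed
  moreover have "- 4 * L / \<Delta> * x\<^sup>2 + b k * x + c k \<le> f x"
    if "k \<in> {1..K}" "x \<in> {xl..xu}" for k x
    unfolding vertex_form
    by (rule parabola_below_lipschitz[OF assms(3) \<open>A > 0\<close> m_in[OF that(1)] that(2)])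
  ultimately show ?thesis
    unfolding Let_def by (intro exI[of _ D] exI[of _ b] exI[of _ c] conjI) blast+
qed

end
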